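(* Let $p$ and $q$ be primes with $q\equiv 1\pmod p$, let $G$ be isomorphic to $F_{p,q}$, the non-abelian group of order $pq$, and let $\Gamma=\mathcal{E}_c^-(G)$. Then $M_1(\Gamma)=q(q-1)^2(p-1)^3$ and $M_2(\Gamma)=\frac{q(q-1)^3(p-1)^4}{2}$. Further, $\frac{M_2(\Gamma)}{|e(\Gamma)|}=(q-1)^2(p-1)^2=\frac{M_1(\Gamma)}{|v(\Gamma)|}$.
   Context: For elements $x,y$ of a group, $[x,y]=x^{-1}y^{-1}xy$, $[x,{}_1y]=[x,y]$ and $[x,{}_{k+1}y]=[[x,{}_ky],y]$ for $k\ge 1$. For a finite group $G$ with Fitting subgroup $F(G)$, $\mathcal{E}_c^-(G)$ is the simple undirected graph with vertex set $G\setminus F(G)$ in which distinct $x,y$ are adjacent iff $[x,{}_ky]\neq 1$ and $[y,{}_kx]\neq 1$ for all positive integers $k$. Explicitly, $F_{p,q}=\langle a,b\mid a^p=b^q=1,\ a^{-1}ba=b^r\rangle$ with $r^p\equiv 1\pmod q$ and $r\not\equiv 1\pmod q$. For a finite simple graph $\Gamma$ with vertex set $v(\Gamma)$ and edge set $e(\Gamma)$, the first and second Zagreb indices are $M_1(\Gamma)=\sum_{v\in v(\Gamma)}\deg(v)^2$ and $M_2(\Gamma)=\sum_{uv\in e(\Gamma)}\deg(u)\deg(v)$. *)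

theory Defs
  imports Complex_Main "HOL-Algebra.Generated_Groups" "HOL-Number_Theory.Cong"
begin

section \<open>Engel commutators, nilpotency and the Fitting subgroup\<close>

text \<open>The convention is $[x,y] = x^{-1}y^{-1}xy$; \<^const>\<open>derived\<close> in the library is built on
  $xyx^{-1}y^{-1}$ instead.\<close>

definition commutator :: "('a, 'b) monoid_scheme \<Rightarrow> 'a \<Rightarrow> 'a \<Rightarrow> 'a" where
  "commutator G x y = inv\<^bsub>G\<^esub> x \<otimes>\<^bsub>G\<^esub> inv\<^bsub>G\<^esub> y \<otimes>\<^bsub>G\<^esub> x \<otimes>\<^bsub>G\<^esub> y"

text \<open>\<open>engel_comm G x k y\<close> is $[x,{}_k y]$, extended by $[x,{}_0 y] = x$.\<close>

primrec engel_comm :: "('a, 'b) monoid_scheme \<Rightarrow> 'a \<Rightarrow> nat \<Rightarrow> 'a \<Rightarrow> 'a" where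
  "engel_comm G x 0 y = x"
| "engel_comm G x (Suc k) y = commutator G (engel_comm G x k y) y"

primrec lower_central :: "('a, 'b) monoid_scheme \<Rightarrow> nat \<Rightarrow> 'a set" where
  "lower_central G 0 = carrier G"
| "lower_central G (Suc n) =
     generate G {commutator G x y | x y. x \<in> lower_central G n \<and> y \<in> carrier G}"

definition nilpotent_group :: "('a, 'b) monoid_scheme \<Rightarrow> bool" where
  "nilpotent_group G \<longleftrightarrow> group G \<and> (\<exists>n. lower_central G n = {\<one>\<^bsub>G\<^esub>})"

definition Fitting_subgroup :: "('a, 'b) monoid_scheme \<Rightarrow> 'a set" where
  "Fitting_subgroup G = generate G (\<Union>{N. N \<lhd> G \<and> nilpotent_group (G\<lparr>carrier := N\<rparr>)})"


section \<open>Simple graphs and Zagreb indices\<close>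

text \<open>A simple undirected graph is a pair of a vertex set and a set of two-element sets of
  vertices.\<close>

type_synonym 'a sgraph = "'a set \<times> 'a set set"

abbreviation vertices :: "'a sgraph \<Rightarrow> 'a set" where "vertices \<equiv> fst"
abbreviation edges :: "'a sgraph \<Rightarrow> 'a set set" where "edges \<equiv> snd"

definition vertex_degree :: "'a sgraph \<Rightarrow> 'a \<Rightarrow> nat" where
  "vertex_degree \<Gamma> v = card {e \<in> edges \<Gamma>. v \<in> e}"

definition Zagreb1 :: "'a sgraph \<Rightarrow> nat" where
  "Zagreb1 \<Gamma> = (\<Sum>v\<in>vertices \<Gamma>. vertex_degree \<Gamma> v ^ 2)"

text \<open>An edge is the set of its two endpoints, so each edge contributes once.\<close>

definition Zagreb2 :: "'a sgraph \<Rightarrow> nat" where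
  "Zagreb2 \<Gamma> = (\<Sum>e\<in>edges \<Gamma>. \<Prod>v\<in>e. vertex_degree \<Gamma> v)"

definition non_Engel_graph :: "('a, 'b) monoid_scheme \<Rightarrow> 'a sgraph" where
  "non_Engel_graph G =
     (carrier G - Fitting_subgroup G,
      {{x, y} | x y.
         x \<in> carrier G - Fitting_subgroup G \<and> y \<in> carrier G - Fitting_subgroup G \<and> x \<noteq> y \<and>
         (\<forall>k\<ge>1. engel_comm G x k y \<noteq> \<one>\<^bsub>G\<^esub> \<and> engel_comm G y k x \<noteq> \<one>\<^bsub>G\<^esub>)})"


section \<open>Group presentations\<close>

text \<open>A letter \<open>(g, True)\<close> stands for the generator \<open>g\<close>, and \<open>(g, False)\<close> for its inverse.
  A relation $u = v$ is the pair \<open>(u, v)\<close>. The generators are all elements of the type \<open>'g\<close>.\<close>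

type_synonym 'g gword = "('g \<times> bool) list"

inductive word_eq :: "('g gword \<times> 'g gword) set \<Rightarrow> 'g gword \<Rightarrow> 'g gword \<Rightarrow> bool"
  for R where
  refl: "word_eq R u u"
| sym: "word_eq R u v \<Longrightarrow> word_eq R v u"
| trans: "word_eq R u v \<Longrightarrow> word_eq R v w \<Longrightarrow> word_eq R u w"
| cancel: "word_eq R (u @ [(g, s), (g, \<not> s)] @ v) (u @ v)"
| relation: "(l, r) \<in> R \<Longrightarrow> word_eq R (u @ l @ v) (u @ r @ v)"

definition word_class :: "('g gword \<times> 'g gword) set \<Rightarrow> 'g gword \<Rightarrow> 'g gword set" where
  "word_class R u = {v. word_eq R u v}"

definition presented_group :: "('g gword \<times> 'g gword) set \<Rightarrow> 'g gword set monoid" where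
  "presented_group R =
     \<lparr>carrier = range (word_class R),
      monoid.mult = (\<lambda>A B. {w. \<exists>u\<in>A. \<exists>v\<in>B. word_eq R (u @ v) w}),
      one = word_class R []\<rparr>"

lemma word_eq_context: "word_eq R u v \<Longrightarrow> word_eq R (a @ u @ b) (a @ v @ b)"
proof (induction rule: word_eq.induct)
  case (cancel u g s v)
  show ?case using word_eq.cancel[of R "a @ u" g s "v @ b"] by simp
next
  case (relation l r u v)
  then show ?case using word_eq.relation[of l r R "a @ u" "v @ b"] by simp
qed (blast intro: word_eq.refl word_eq.sym word_eq.trans)+

lemma word_eq_append: "word_eq R u u' \<Longrightarrow> word_eq R v v' \<Longrightarrow> word_eq R (u @ v) (u' @ v')"
  using word_eq_context[of R u u' "[]" v] word_eq_context[of R v v' u' "[]"]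
  by (auto intro: word_eq.trans)

lemma word_class_eq_iff: "word_class R u = word_class R v \<longleftrightarrow> word_eq R u v"
  unfolding word_class_def by (blast intro: word_eq.refl word_eq.sym word_eq.trans)

lemma presented_group_mult:
  "word_class R u \<otimes>\<^bsub>presented_group R\<^esub> word_class R v = word_class R (u @ v)"
  unfolding presented_group_def word_class_def
  by (auto intro: word_eq.refl word_eq.sym word_eq.trans word_eq_append)

definition word_inv :: "'g gword \<Rightarrow> 'g gword" where
  "word_inv u = rev (map (\<lambda>(g, s). (g, \<not> s)) u)"

lemma word_eq_inv_left: "word_eq R (word_inv u @ u) []"
proof (induction u)
  case Nil
  show ?case by (simp add: word_inv_def word_eq.refl)
next
  case (Cons x u)
  obtain g s where x: "x = (g, s)" by force
  have "word_eq R (word_inv u @ [(g, \<not> s), (g, \<not> \<not> s)] @ u) (word_inv u @ u)"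
    by (rule word_eq.cancel)
  with Cons.IH show ?case by (simp add: x word_inv_def) (blast intro: word_eq.trans)
qed

lemma group_presented_group: "group (presented_group R)"
proof (rule groupI)
  show "\<one>\<^bsub>presented_group R\<^esub> \<in> carrier (presented_group R)"
    by (simp add: presented_group_def)
next
  fix x y assume "x \<in> carrier (presented_group R)" "y \<in> carrier (presented_group R)"
  then obtain u v where "x = word_class R u" "y = word_class R v"
    by (auto simp: presented_group_def)
  then show "x \<otimes>\<^bsub>presented_group R\<^esub> y \<in> carrier (presented_group R)"
    by (simp add: presented_group_mult) (simp add: presented_group_def)
next
  fix x y z
  assume "x \<in> carrier (presented_group R)" "y \<in> carrier (presented_group R)"
    "z \<in> carrier (presented_group R)"
  then obtain u v w where "x = word_class R u" "y = word_class R v" "z = word_class R w"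
    by (auto simp: presented_group_def)
  then show "x \<otimes>\<^bsub>presented_group R\<^esub> y \<otimes>\<^bsub>presented_group R\<^esub> z =
      x \<otimes>\<^bsub>presented_group R\<^esub> (y \<otimes>\<^bsub>presented_group R\<^esub> z)"
    by (simp add: presented_group_mult)
next
  fix x assume "x \<in> carrier (presented_group R)"
  then obtain u where u: "x = word_class R u"
    by (auto simp: presented_group_def)
  have one: "\<one>\<^bsub>presented_group R\<^esub> = word_class R []"
    by (simp add: presented_group_def)
  show "\<one>\<^bsub>presented_group R\<^esub> \<otimes>\<^bsub>presented_group R\<^esub> x = x"
    by (simp add: one u presented_group_mult)
  have "word_class R (word_inv u) \<otimes>\<^bsub>presented_group R\<^esub> x = \<one>\<^bsub>presented_group R\<^esub>"
    by (simp add: one u presented_group_mult word_class_eq_iff word_eq_inv_left)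
  then show "\<exists>y\<in>carrier (presented_group R). y \<otimes>\<^bsub>presented_group R\<^esub> x = \<one>\<^bsub>presented_group R\<^esub>"
    by (auto simp: presented_group_def)
qed

definition gen_pow :: "'g \<Rightarrow> int \<Rightarrow> 'g gword" where
  "gen_pow g k = replicate (nat \<bar>k\<bar>) (g, 0 \<le> k)"

datatype F_gen = gen_a | gen_b

definition F_group :: "nat \<Rightarrow> nat \<Rightarrow> int \<Rightarrow> F_gen gword set monoid" where
  "F_group p q r = presented_group
     {(gen_pow gen_a (int p), []),
      (gen_pow gen_b (int q), []),
      (gen_pow gen_a (- 1) @ gen_pow gen_b 1 @ gen_pow gen_a 1, gen_pow gen_b r)}"

end

(* The group is non-abelian of order p q with a normal subgroup N of order q and abelian quotient,
   and no element outside N commutes with a nontrivial element of N. So commutators lie in N, and as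
   soon as [x, y] is nontrivial with y outside N, all [x, _k y] are nontrivial. Hence the Fitting
   subgroup is N and two vertices are adjacent iff they do not commute. The centralizer of an element
   outside N has order p and meets N trivially, so the graph is regular of degree (p - 1)(q - 1) on
   q(p - 1) vertices, which determines both indices. That the presentation does not collapse is seen
   from a concrete model on pairs (i, j). *)

theory Submission
  imports Defs "HOL-Algebra.Elementary_Groups"
begin

section \<open>Degrees and Zagreb indices of regular graphs\<close>

text \<open>The edges at \<open>v\<close> are the pairs \<open>{v, y}\<close>, one for each
  neighbour \<open>y\<close>. Symmetry of \<open>adj\<close> covers edges listed with
  \<open>v\<close> in second place.\<close>

lemma vertex_degree_adjacency:
  assumes "edges \<Gamma> = {{x, y} | x y. x \<in> V \<and> y \<in> V \<and> x \<noteq> y \<and> adj x y}"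
    and "\<And>x y. adj x y \<longleftrightarrow> adj y x" and "v \<in> V"
  shows "vertex_degree \<Gamma> v = card {y \<in> V. y \<noteq> v \<and> adj v y}"
proof -
  have "{e \<in> edges \<Gamma>. v \<in> e} = (\<lambda>y. {v, y}) ` {y \<in> V. y \<noteq> v \<and> adj v y}"
    unfolding assms(1) using assms(2,3) by (auto simp: image_iff)
  moreover have "inj_on (\<lambda>y. {v, y}) {y \<in> V. y \<noteq> v \<and> adj v y}"
    by (auto simp: inj_on_def doubleton_eq_iff)
  ultimately show ?thesis
    by (simp add: vertex_degree_def card_image)
qed

lemma regular_graph_Zagreb:
  assumes fin: "finite (vertices \<Gamma>)"
    and edge: "\<And>e. e \<in> edges \<Gamma> \<Longrightarrow> e \<subseteq> vertices \<Gamma> \<and> card e = 2"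
    and deg: "\<And>v. v \<in> vertices \<Gamma> \<Longrightarrow> vertex_degree \<Gamma> v = d"
  shows "Zagreb1 \<Gamma> = card (vertices \<Gamma>) * d ^ 2"
    and "Zagreb2 \<Gamma> = card (edges \<Gamma>) * d ^ 2"
    and "2 * card (edges \<Gamma>) = card (vertices \<Gamma>) * d"
proof -
  show "Zagreb1 \<Gamma> = card (vertices \<Gamma>) * d ^ 2"
    by (simp add: Zagreb1_def deg)
  have "(\<Prod>v\<in>e. vertex_degree \<Gamma> v) = d ^ 2" if "e \<in> edges \<Gamma>" for e
  proof -
    have "(\<Prod>v\<in>e. vertex_degree \<Gamma> v) = (\<Prod>v\<in>e. d)"
      using edge[OF that] deg by (intro prod.cong) auto
    then show ?thesis using edge[OF that] by simp
  qed
  then show "Zagreb2 \<Gamma> = card (edges \<Gamma>) * d ^ 2"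
    by (simp add: Zagreb2_def)
  have finE: "finite (edges \<Gamma>)"
    by (rule finite_subset[of _ "Pow (vertices \<Gamma>)"]) (use edge fin in blast, simp add: fin)
  have "{v \<in> vertices \<Gamma>. v \<in> e} = e" if "e \<in> edges \<Gamma>" for e
    using edge[OF that] by auto
  \<comment> \<open>Double counting of incidences: every edge is met by exactly two
    vertices.\<close>
  then have "(\<Sum>v\<in>vertices \<Gamma>. card {e \<in> edges \<Gamma>. v \<in> e}) = 2 * card (edges \<Gamma>)"
    using fin finE edge by (intro sum_multicount) auto
  then show "2 * card (edges \<Gamma>) = card (vertices \<Gamma>) * d"
    using deg by (simp add: vertex_degree_def)
qed

section \<open>Centralizers, groups of prime order and commutators\<close>

definition centralizer :: "('a, 'b) monoid_scheme \<Rightarrow> 'a \<Rightarrow> 'a set" where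
  "centralizer G x = {y \<in> carrier G. x \<otimes>\<^bsub>G\<^esub> y = y \<otimes>\<^bsub>G\<^esub> x}"

context group
begin

lemma subgroup_centralizer:
  assumes x: "x \<in> carrier G"
  shows "subgroup (centralizer G x) G"
proof
  fix y z assume "y \<in> centralizer G x" "z \<in> centralizer G x"
  then show "y \<otimes> z \<in> centralizer G x"
    using x by (simp add: centralizer_def) (metis m_assoc)
next
  fix y assume "y \<in> centralizer G x"
  then have y: "y \<in> carrier G" "x \<otimes> y = y \<otimes> x" by (auto simp: centralizer_def)
  then have "inv y \<otimes> (x \<otimes> y) = x" using x by (simp add: inv_solve_left')
  then have "x \<otimes> inv y = inv y \<otimes> x"
    using x y(1) by (simp only: inv_solve_right' inv_closed m_closed m_assoc)
  then show "inv y \<in> centralizer G x"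
    using y(1) by (simp add: centralizer_def)
qed (use x in \<open>auto simp: centralizer_def\<close>)

lemma prime_order_subgroup:
  assumes "prime (order G)" "subgroup H G" "x \<in> H" "x \<noteq> \<one>"
  shows "H = carrier G"
proof -
  have fin: "finite (carrier G)"
    using assms(1) by (metis order_gt_0_iff_finite prime_gt_0_nat)
  have sub: "H \<subseteq> carrier G"
    using assms(2) subgroup.subset by blast
  then have finH: "finite H" using fin finite_subset by blast
  have "card H dvd order G"
    using lagrange[OF assms(2)] by (metis dvd_triv_right)
  moreover have "card H \<noteq> 1"
    using assms(2-4) by (metis card_1_singletonE singletonD subgroup.one_closed)
  ultimately have "card H = card (carrier G)"
    using assms(1) by (metis order_def prime_nat_iff)
  then show ?thesis using sub fin card_subset_eq by blast
qed

text \<open>The centralizer of a nontrivial \<open>x\<close> is a subgroup containing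
  \<open>x\<close>, hence the whole group.\<close>

lemma prime_order_comm:
  assumes "prime (order G)" "x \<in> carrier G" "y \<in> carrier G"
  shows "x \<otimes> y = y \<otimes> x"
proof (cases "x = \<one>")
  case False
  then have "centralizer G x = carrier G"
    using assms by (intro prime_order_subgroup[of _ x] subgroup_centralizer) (auto simp: centralizer_def)
  then show ?thesis using assms(3) by (auto simp: centralizer_def)
qed (use assms in simp)

lemma commutator_closed [simp]:
  "x \<in> carrier G \<Longrightarrow> y \<in> carrier G \<Longrightarrow> commutator G x y \<in> carrier G"
  by (simp add: commutator_def)

lemma commutator_eq: "x \<in> carrier G \<Longrightarrow> y \<in> carrier G \<Longrightarrow> commutator G x y = inv (y \<otimes> x) \<otimes> (x \<otimes> y)"
  by (simp add: commutator_def inv_mult_group m_assoc)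

lemma commutator_eq_one_iff:
  assumes "x \<in> carrier G" "y \<in> carrier G"
  shows "commutator G x y = \<one> \<longleftrightarrow> x \<otimes> y = y \<otimes> x"
  using assms by (simp add: commutator_eq inv_solve_left')

text \<open>Nilpotency of a subgroup is stated in the restricted structure, whose inverses are
  formed inside \<open>H\<close>; this carries its commutators over to \<open>G\<close>.\<close>

lemma commutator_subgroup:
  assumes "subgroup H G" "x \<in> H" "y \<in> H"
  shows "commutator (G\<lparr>carrier := H\<rparr>) x y = commutator G x y"
  using assms by (simp add: commutator_def m_inv_consistent)

end

section \<open>The non-commuting structure of a non-abelian group of order pq\<close>

text \<open>Collects what the graph computation uses about the group, free of any presentation.
  \<open>N\<close> will be the kernel of the projection onto the integers mod
  \<open>p\<close>.\<close>

locale pq_group = group G for G (structure) +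
  fixes p q :: nat and N
  assumes prime_p: "prime p" and prime_q: "prime q" and p_less_q: "p < q"
    and order_G: "order G = p * q"
    and normal_N: "N \<lhd> G" and card_N: "card N = q"
    and noncomm: "\<exists>x\<in>carrier G. \<exists>y\<in>carrier G. x \<otimes> y \<noteq> y \<otimes> x"
begin

lemma subgroup_N: "subgroup N G"
  using normal_N normal_imp_subgroup by blast

lemma N_closed: "x \<in> N \<Longrightarrow> x \<in> carrier G"
  using subgroup_N subgroup.subset by blast

lemma finite_G: "finite (carrier G)"
  using order_G prime_p prime_q by (metis nat_0_less_mult_iff order_gt_0_iff_finite prime_gt_0_nat)

lemma order_Mod: "order (G Mod N) = p"
  using lagrange[OF subgroup_N] order_G card_N prime_q
  by (simp add: FactGroup_def order_def)

text \<open>\<open>N\<close> has prime order, so its nontrivial subgroup \<open>N \<inter> H\<close>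
  is all of \<open>N\<close>.\<close>

lemma subgroup_within_N:
  assumes "subgroup H G" "c \<in> H" "c \<in> N" "c \<noteq> \<one>"
  shows "N \<subseteq> H"
proof -
  interpret N: group "G\<lparr>carrier := N\<rparr>"
    using subgroup_N subgroup_imp_group by blast
  have "subgroup (N \<inter> H) (G\<lparr>carrier := N\<rparr>)"
    using subgroups_Inter_pair[OF subgroup_N assms(1)] subgroup_N by (intro subgroup_incl) auto
  then have "N \<inter> H = N"
    using N.prime_order_subgroup[of "N \<inter> H" c] assms card_N prime_q by (simp add: order_def)
  then show ?thesis by blast
qed

lemma N_comm: "x \<in> N \<Longrightarrow> y \<in> N \<Longrightarrow> x \<otimes> y = y \<otimes> x"
  using group.prime_order_comm[OF subgroup_imp_group[OF subgroup_N], of x y] card_N prime_q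
  by (simp add: order_def)

text \<open>The quotient by \<open>N\<close> has prime order \<open>p\<close>, so it is abelian, and
  \<open>x \<otimes> y\<close> and \<open>y \<otimes> x\<close> lie in the same coset.\<close>

lemma commutator_in_N:
  assumes x: "x \<in> carrier G" and y: "y \<in> carrier G"
  shows "commutator G x y \<in> N"
proof -
  interpret N: normal N G by (rule normal_N)
  have "N #> (x \<otimes> y) = (N #> x) <#> (N #> y)"
    using N.rcos_sum x y by simp
  also have "\<dots> = (N #> y) <#> (N #> x)"
    using group.prime_order_comm[OF N.factorgroup_is_group, of "N #> x" "N #> y"]
      order_Mod prime_p x y by (auto simp: FactGroup_def RCOSETS_def)
  also have "\<dots> = N #> (y \<otimes> x)"
    using N.rcos_sum x y by simp
  finally have "x \<otimes> y \<in> N #> (y \<otimes> x)"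
    using x y rcos_self[OF _ subgroup_N] by blast
  then obtain n where n: "n \<in> N" "x \<otimes> y = n \<otimes> (y \<otimes> x)"
    by (auto simp: r_coset_def)
  \<comment> \<open>The commutator is thus a conjugate of \<open>n\<close>, and normality
    applies.\<close>
  then have "commutator G x y = inv (y \<otimes> x) \<otimes> n \<otimes> (y \<otimes> x)"
    using x y N_closed by (simp add: commutator_eq m_assoc)
  then show ?thesis using N.inv_op_closed1[of "y \<otimes> x" n] n x y by simp
qed

text \<open>The index of \<open>N\<close> is prime: \<open>card H = m * q\<close> with
  \<open>m\<close> dividing \<open>p\<close>, and the element \<open>x\<close> excludes
  \<open>m = 1\<close>.\<close>

lemma N_maximal:
  assumes H: "subgroup H G" "N \<subseteq> H" and x: "x \<in> H" "x \<notin> N"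
  shows "H = carrier G"
proof -
  have sub: "H \<subseteq> carrier G" using H subgroup.subset by blast
  then have finH: "finite H" using finite_G finite_subset by blast
  have "subgroup N (G\<lparr>carrier := H\<rparr>)"
    using H subgroup_N subgroup_incl by blast
  then obtain m where m: "card H = m * q"
    using group.lagrange[OF subgroup_imp_group[OF H(1)], of N] card_N
    by (auto simp: order_def intro: that[OF HOL.sym])
  have "card H dvd p * q"
    using lagrange[OF H(1)] order_G by (metis dvd_triv_right)
  then have "m dvd p" using m prime_q by auto
  moreover have "m \<noteq> 1"
    using psubset_card_mono[OF finH, of N] H(2) x card_N m by auto
  ultimately have "card H = card (carrier G)"
    using prime_p m order_G by (metis order_def prime_nat_iff)
  then show ?thesis using sub finite_G card_subset_eq by blast
qed

text \<open>If \<open>x\<close> centralises some \<open>c\<close> in \<open>N\<close>, then so does the subgroup generated by \<open>N\<close> and \<open>x\<close>,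
  which is everything; the centraliser of each \<open>y\<close> outside \<open>N\<close> then contains \<open>c\<close>, hence \<open>N\<close>
  and \<open>y\<close>, hence everything.\<close>

lemma N_outside_noncomm:
  assumes c: "c \<in> N" "c \<noteq> \<one>" and x: "x \<in> carrier G" "x \<notin> N"
  shows "c \<otimes> x \<noteq> x \<otimes> c"
proof
  assume eq: "c \<otimes> x = x \<otimes> c"
  have "centralizer G c = carrier G"
    using c x eq N_comm N_closed
    by (intro N_maximal[of _ x] subgroup_centralizer) (auto simp: centralizer_def)
  then have "c \<in> centralizer G y" if "y \<in> carrier G" for y
    using that c N_closed unfolding centralizer_def by (metis (mono_tags, lifting) mem_Collect_eq)
  then have N_cent: "N \<subseteq> centralizer G y" if "y \<in> carrier G" for y
    using that c subgroup_within_N subgroup_centralizer by blast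
  have "centralizer G y = carrier G" if "y \<in> carrier G" "y \<notin> N" for y
    using that N_cent by (intro N_maximal[of _ y] subgroup_centralizer) (auto simp: centralizer_def)
  then have "y \<otimes> z = z \<otimes> y" if "y \<in> carrier G" "z \<in> carrier G" for y z
    using that N_cent[of z] by (cases "y \<in> N") (auto simp: centralizer_def)
  then show False using noncomm by blast
qed

text \<open>A trivial intersection with \<open>N\<close> makes multiplication from
  \<open>centralizer G x \<times> N\<close> to the group injective, so the centralizer has at most
  \<open>p < q\<close> elements. Its order is then coprime to \<open>q\<close>, divides
  \<open>p\<close>, and is not 1 because of \<open>x\<close>.\<close>

lemma card_centralizer:
  assumes x: "x \<in> carrier G" "x \<notin> N"
  shows "centralizer G x \<inter> N = {\<one>}" and "card (centralizer G x) = p"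
proof -
  let ?C = "centralizer G x"
  have sub: "subgroup ?C G" using x subgroup_centralizer by blast
  show CN: "?C \<inter> N = {\<one>}"
    using N_outside_noncomm[OF _ _ x] subgroup.one_closed[OF sub] subgroup.one_closed[OF subgroup_N]
    by (auto simp: centralizer_def) metis
  have finC: "finite ?C" using finite_G by (simp add: centralizer_def)
  have closed: "y \<in> carrier G" if "y \<in> ?C" for y using that by (simp add: centralizer_def)
  have "inj_on (\<lambda>(y, n). y \<otimes> n) (?C \<times> N)"
  proof (rule inj_onI, clarify)
    fix y n z m assume *: "y \<in> ?C" "n \<in> N" "z \<in> ?C" "m \<in> N" "y \<otimes> n = z \<otimes> m"
    then have "inv z \<otimes> (y \<otimes> n) = m"
      using closed N_closed by (simp add: inv_solve_left')
    then have "inv z \<otimes> y = m \<otimes> inv n"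
      using * closed N_closed by (simp add: inv_solve_right m_assoc)
    moreover have "inv z \<otimes> y \<in> ?C" using * sub by (simp add: subgroup.m_closed subgroup.m_inv_closed)
    moreover have "m \<otimes> inv n \<in> N" using * subgroup_N by (simp add: subgroup.m_closed subgroup.m_inv_closed)
    ultimately have "inv z \<otimes> y = \<one>" using CN by auto
    then have "y = z" using * closed by (simp add: inv_solve_left')
    then show "y = z \<and> n = m" using * closed N_closed by simp
  qed
  then have "card (?C \<times> N) \<le> card (carrier G)"
    using closed N_closed by (intro card_inj_on_le[OF _ _ finite_G]) auto
  then have "card ?C \<le> p"
    using card_N order_G prime_q by (simp add: card_cartesian_product order_def prime_gt_0_nat)
  moreover have "card ?C > 0" using finC x by (auto simp: card_gt_0_iff centralizer_def)
  ultimately have "coprime (card ?C) q"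
    using p_less_q prime_q by (metis coprime_commute leD le_less_trans nat_dvd_not_less prime_imp_coprime)
  moreover have "card ?C dvd p * q"
    using lagrange[OF sub] order_G by (metis dvd_triv_right)
  ultimately have "card ?C dvd p" using coprime_dvd_mult_left_iff by blast
  moreover have "card ?C \<noteq> 1"
  proof
    assume "card ?C = 1"
    moreover have "x \<in> ?C" "\<one> \<in> ?C" using x by (auto simp: centralizer_def)
    ultimately have "x = \<one>" by (metis card_1_singletonE singletonD)
    then show False using x subgroup.one_closed[OF subgroup_N] by simp
  qed
  ultimately show "card ?C = p" using prime_p by (metis prime_nat_iff)
qed

text \<open>The persistence step: taking commutators with \<open>x\<close> never leaves the
  nontrivial elements of \<open>N\<close>. Both the Engel commutators and the failure of nilpotency
  rest on it.\<close>

lemma commutator_N_outside: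
  assumes "c \<in> N" "c \<noteq> \<one>" "x \<in> carrier G" "x \<notin> N"
  shows "commutator G c x \<in> N - {\<one>}"
  using N_outside_noncomm[OF assms] commutator_in_N[of c x] commutator_eq_one_iff[of c x]
    N_closed[OF assms(1)] assms(3) by blast

text \<open>\<open>N\<close> is abelian, so its lower central series is trivial from index 1
  on.\<close>

lemma nilpotent_N: "nilpotent_group (G\<lparr>carrier := N\<rparr>)"
proof -
  interpret N: group "G\<lparr>carrier := N\<rparr>"
    using subgroup_N subgroup_imp_group by blast
  let ?A = "{commutator (G\<lparr>carrier := N\<rparr>) x y | x y. x \<in> N \<and> y \<in> N}"
  have "commutator (G\<lparr>carrier := N\<rparr>) x y = \<one>" if "x \<in> N" "y \<in> N" for x y
    using N.commutator_eq_one_iff[of x y] that N_comm by simp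
  then have "?A \<subseteq> {\<one>\<^bsub>G\<lparr>carrier := N\<rparr>\<^esub>}" by auto
  then have "generate (G\<lparr>carrier := N\<rparr>) ?A \<subseteq> {\<one>\<^bsub>G\<lparr>carrier := N\<rparr>\<^esub>}"
    using N.generate_subgroup_incl N.triv_subgroup by blast
  then have "lower_central (G\<lparr>carrier := N\<rparr>) (Suc 0) = {\<one>\<^bsub>G\<lparr>carrier := N\<rparr>\<^esub>}"
    using generate.one[of "G\<lparr>carrier := N\<rparr>" ?A] by auto
  then show ?thesis
    unfolding nilpotent_group_def using N.is_group by blast
qed

text \<open>A normal subgroup containing some \<open>x\<close> outside \<open>N\<close> contains a nontrivial \<open>[c, x]\<close> with
  \<open>c\<close> in \<open>N\<close>, and the iterated commutators with \<open>x\<close> never die out.\<close>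

lemma normal_nilpotent_subset:
  assumes K: "K \<lhd> G" and nil: "nilpotent_group (G\<lparr>carrier := K\<rparr>)"
  shows "K \<subseteq> N"
proof
  interpret K: normal K G by (rule K)
  let ?L = "lower_central (G\<lparr>carrier := K\<rparr>)"
  fix x assume xK: "x \<in> K"
  show "x \<in> N"
  proof (rule ccontr)
    assume xN: "x \<notin> N"
    have x: "x \<in> carrier G" using xK K.subset by blast
    obtain c where c: "c \<in> N" "c \<noteq> \<one>"
    proof -
      have "\<not> N \<subseteq> {\<one>}"
        using card_N prime_q card_mono[of "{\<one>}" N] prime_gt_1_nat[of q] by auto
      then show ?thesis using that by blast
    qed
    \<comment> \<open>Membership in \<open>K\<close> is carried along because commutators of the
      restricted structure are compared with those of \<open>G\<close> only for elements of
      \<open>K\<close>.\<close>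
    have "\<exists>d \<in> ?L n. d \<in> N - {\<one>} \<and> d \<in> K" for n
    proof (induction n)
      case 0
      \<comment> \<open>The element \<open>c\<close> may lie outside \<open>K\<close>, but
        \<open>[c, x]\<close> is a conjugate of \<open>inv x\<close> times \<open>x\<close>, which
        normality places in \<open>K\<close>.\<close>
      have "commutator G c x = (inv c \<otimes> inv x \<otimes> c) \<otimes> x"
        by (simp add: commutator_def)
      then have "commutator G c x \<in> K"
        using K.inv_op_closed1[of c "inv x"] xK c N_closed by auto
      then show ?case using commutator_N_outside[OF c x xN] by auto
    next
      case (Suc n)
      then obtain d where d: "d \<in> ?L n" "d \<in> N" "d \<noteq> \<one>" "d \<in> K" by blast
      have eq: "commutator (G\<lparr>carrier := K\<rparr>) d x = commutator G d x"
        using commutator_subgroup[OF K.subgroup_axioms] d xK by blast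
      have "commutator G d x \<in> K"
        unfolding commutator_def using d xK by simp
      moreover have "commutator G d x \<in> ?L (Suc n)"
        unfolding lower_central.simps eq[symmetric] using d xK by (intro generate.incl) auto
      ultimately show ?case using commutator_N_outside[OF d(2,3) x xN] by blast
    qed
    then show False using nil unfolding nilpotent_group_def by fastforce
  qed
qed

text \<open>\<open>N\<close> belongs to the family of normal nilpotent subgroups and contains every
  other member.\<close>

lemma Fitting_subgroup_eq: "Fitting_subgroup G = N"
proof -
  have "\<Union>{K. K \<lhd> G \<and> nilpotent_group (G\<lparr>carrier := K\<rparr>)} = N"
    using normal_nilpotent_subset normal_N nilpotent_N by blast
  then show ?thesis
    unfolding Fitting_subgroup_def
    using generate_subgroup_incl[OF _ subgroup_N, of N] generate.incl[of _ N G] by auto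
qed

lemma engel_comm_nontrivial:
  assumes "x \<in> carrier G" "y \<in> carrier G" "y \<notin> N" "x \<otimes> y \<noteq> y \<otimes> x" "k \<ge> 1"
  shows "engel_comm G x k y \<in> N - {\<one>}"
  using \<open>k \<ge> 1\<close>
\<comment> \<open>The induction starts at 1, where the commutator first enters \<open>N\<close>; at
  0 the value is \<open>x\<close>, which may lie outside.\<close>
proof (induction k rule: dec_induct)
  case base
  show ?case using assms commutator_in_N commutator_eq_one_iff by simp
next
  case (step k)
  then show ?case using assms commutator_N_outside by simp
qed

text \<open>The case \<open>k = 1\<close> already expresses that \<open>x\<close> and
  \<open>y\<close> do not commute; conversely \<open>engel_comm_nontrivial\<close> applies in both
  orders, as both vertices lie outside \<open>N\<close>.\<close>

lemma non_Engel_graph_eq: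
  "non_Engel_graph G = (carrier G - N,
     {{x, y} | x y. x \<in> carrier G - N \<and> y \<in> carrier G - N \<and> x \<noteq> y \<and> x \<otimes> y \<noteq> y \<otimes> x})"
proof -
  have adj: "(\<forall>k\<ge>1. engel_comm G x k y \<noteq> \<one> \<and> engel_comm G y k x \<noteq> \<one>) \<longleftrightarrow> x \<otimes> y \<noteq> y \<otimes> x"
    if "x \<in> carrier G - N" "y \<in> carrier G - N" for x y
  proof
    assume "\<forall>k\<ge>1. engel_comm G x k y \<noteq> \<one> \<and> engel_comm G y k x \<noteq> \<one>"
    then have "engel_comm G x 1 y \<noteq> \<one>" by blast
    then show "x \<otimes> y \<noteq> y \<otimes> x"
      using that by (simp add: commutator_eq_one_iff)
  qed (use that engel_comm_nontrivial in force)
  show ?thesis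
    unfolding non_Engel_graph_def Fitting_subgroup_eq
    by (intro arg_cong2[where f = Pair] HOL.refl Collect_cong ex_cong1 conj_cong) (rule adj)
qed

lemma card_vertices: "card (vertices (non_Engel_graph G)) = q * (p - 1)"
proof -
  have "card (carrier G - N) = card (carrier G) - card N"
    using subgroup_N finite_G by (intro card_Diff_subset) (auto intro: finite_subset subgroup.subset dest: N_closed)
  then show ?thesis
    using order_G card_N by (simp add: non_Engel_graph_eq order_def right_diff_distrib' mult.commute)
qed

lemma degree:
  assumes v: "v \<in> vertices (non_Engel_graph G)"
  shows "vertex_degree (non_Engel_graph G) v = (q - 1) * (p - 1)"
proof -
  let ?C = "centralizer G v"
  have v: "v \<in> carrier G" "v \<notin> N" using v by (auto simp: non_Engel_graph_eq)
  have fin: "finite ?C" using finite_G by (simp add: centralizer_def)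
  have one: "\<one> \<in> ?C" using v by (simp add: centralizer_def)
  have "vertex_degree (non_Engel_graph G) v
      = card {y \<in> carrier G - N. y \<noteq> v \<and> v \<otimes> y \<noteq> y \<otimes> v}"
    using v by (intro vertex_degree_adjacency) (auto simp: non_Engel_graph_eq)
  \<comment> \<open>The vertices not adjacent to \<open>v\<close>, including \<open>v\<close>
    itself, are the nontrivial elements of its centralizer, since the centralizer meets
    \<open>N\<close> only in the identity.\<close>
  also have "{y \<in> carrier G - N. y \<noteq> v \<and> v \<otimes> y \<noteq> y \<otimes> v} = (carrier G - N) - (?C - {\<one>})"
    using card_centralizer(1)[OF v] subgroup.one_closed[OF subgroup_N] by (auto simp: centralizer_def)
  also have "card \<dots> = card (carrier G - N) - card (?C - {\<one>})"
    using card_centralizer(1)[OF v] fin by (intro card_Diff_subset) (auto simp: centralizer_def)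
  also have "\<dots> = q * (p - 1) - (p - 1)"
    using card_vertices card_centralizer(2)[OF v] fin one
    by (simp add: non_Engel_graph_eq card_Diff_singleton)
  finally show ?thesis by (simp add: diff_mult_distrib)
qed

end

section \<open>Evaluation of words and normal forms\<close>

text \<open>The homomorphic extension to words of an assignment \<open>g\<close> of the
  generators.\<close>

primrec word_eval :: "('a, 'b) monoid_scheme \<Rightarrow> ('g \<Rightarrow> 'a) \<Rightarrow> 'g gword \<Rightarrow> 'a" where
  "word_eval H g [] = \<one>\<^bsub>H\<^esub>"
| "word_eval H g (x # u) = (if snd x then g (fst x) else inv\<^bsub>H\<^esub> g (fst x)) \<otimes>\<^bsub>H\<^esub> word_eval H g u"

context group
begin

lemma word_eval_closed [simp]: "range g \<subseteq> carrier G \<Longrightarrow> word_eval G g u \<in> carrier G"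
  by (induction u) auto

lemma word_eval_append:
  "range g \<subseteq> carrier G \<Longrightarrow> word_eval G g (u @ v) = word_eval G g u \<otimes> word_eval G g v"
  by (induction u) (auto simp: m_assoc range_subsetD)

lemma word_eval_gen_pow:
  assumes "range g \<subseteq> carrier G"
  shows "word_eval G g (gen_pow x k) = g x [^] k"
proof -
  have x: "g x \<in> carrier G" using assms by blast
  \<comment> \<open>Evaluation peels letters off on the left, while powers grow on the
    right.\<close>
  have comm: "y \<otimes> y [^] n = y [^] n \<otimes> y" if "y \<in> carrier G" for y and n :: nat
    using that by (metis nat_pow_Suc nat_pow_Suc2)
  have pos: "word_eval G g (replicate n (x, True)) = g x [^] n" for n :: nat
    by (induction n) (simp_all add: comm x)
  have neg_pow: "word_eval G g (replicate n (x, False)) = inv (g x) [^] n" for n :: nat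
    by (induction n) (simp_all add: comm x)
  show ?thesis
  proof (cases k rule: int_cases)
    case (nonneg n)
    then show ?thesis using pos by (simp add: gen_pow_def int_pow_int)
  next
    case (neg n)
    moreover have "nat \<bar>- int (Suc n)\<bar> = Suc n" by simp
    ultimately have "gen_pow x k = replicate (Suc n) (x, False)"
      by (simp only: gen_pow_def) simp
    then show ?thesis
      by (simp only: neg neg_pow int_pow_neg_int[OF x] nat_pow_inv[OF x])
  qed
qed

text \<open>Von Dyck's principle: if the relations hold in the target group, evaluation descends to
  word classes.\<close>

lemma word_eval_eq:
  assumes g: "range g \<subseteq> carrier G"
    and R: "\<And>l r. (l, r) \<in> R \<Longrightarrow> word_eval G g l = word_eval G g r"
    and "word_eq R u v"
  shows "word_eval G g u = word_eval G g v"
  using assms(3)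
proof induction
  case (cancel u x s v)
  have x: "g x \<in> carrier G" using g by blast
  then have "g x \<otimes> (inv g x \<otimes> w) = w" "inv g x \<otimes> (g x \<otimes> w) = w" if "w \<in> carrier G" for w
    using that by (simp_all flip: m_assoc)
  then show ?case
    using g by (simp add: word_eval_append)
next
  case (relation l r u v)
  then show ?case using R g by (simp add: word_eval_append)
qed simp_all

text \<open>The relation lets every \<open>b\<close> move to the right past \<open>a\<close>.
  Applied in the presented group, this bounds its order by \<open>m * n\<close>.\<close>

lemma metacyclic_normal_form:
  fixes m n :: nat and r :: int
  assumes g: "range g \<subseteq> carrier G" and ab: "range g = {a, b}" and mn: "m > 0" "n > 0"
    and a: "a [^] m = \<one>" and b: "b [^] n = \<one>" and rel: "inv a \<otimes> b \<otimes> a = b [^] r"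
  shows "word_eval G g u \<in> (\<lambda>(i, j). a [^] i \<otimes> b [^] j) ` ({..<m} \<times> {..<n})"
proof -
  have [simp]: "a \<in> carrier G" "b \<in> carrier G" using g ab by auto
  \<comment> \<open>A natural representative of \<open>r\<close> modulo \<open>n\<close>, so that
    only natural exponents occur below.\<close>
  define s where "s = nat (r mod int n)"
  have pow_mod: "x [^] (i mod k) = x [^] i"
    if "x \<in> carrier G" "x [^] k = \<one>" for x and i k :: nat
  proof -
    have "x [^] i = x [^] (k * (i div k) + i mod k)" by simp
    also have "\<dots> = (x [^] k) [^] (i div k) \<otimes> x [^] (i mod k)"
      using that(1) by (simp only: nat_pow_mult[symmetric] nat_pow_pow[symmetric] nat_pow_closed)
    finally show ?thesis using that by simp
  qed
  have "b [^] r = b [^] (int n * (r div int n) + r mod int n)" by simp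
  also have "\<dots> = (b [^] int n) [^] (r div int n) \<otimes> b [^] (r mod int n)"
    by (simp only: int_pow_mult int_pow_pow \<open>b \<in> carrier G\<close>)
  also have "\<dots> = b [^] s"
    using b mn by (simp add: s_def int_pow_int flip: int_pow_int)
  finally have "inv a \<otimes> (b \<otimes> a) = b [^] s" using rel by (simp add: m_assoc)
  then have ba: "b \<otimes> a = a \<otimes> b [^] s" by (simp add: inv_solve_left')
  have bja: "b [^] j \<otimes> a = a \<otimes> b [^] (j * s)" for j :: nat
  proof (induction j)
    case (Suc j)
    have "b [^] Suc j \<otimes> a = b [^] j \<otimes> a \<otimes> b [^] s" by (simp add: m_assoc ba)
    then show ?case by (simp add: Suc m_assoc nat_pow_mult add.commute)
  qed simp
  \<comment> \<open>Exponents stay unbounded while closure under right multiplication is shown; they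
    are reduced modulo \<open>m\<close> and \<open>n\<close> at the end.\<close>
  define S where "S = {a [^] i \<otimes> b [^] j | (i :: nat) (j :: nat). True}"
  have Sb: "x \<otimes> b [^] k \<in> S" if x: "x \<in> S" for x and k :: nat
  proof -
    obtain i j :: nat where "x = a [^] i \<otimes> b [^] j" using x unfolding S_def by blast
    then have "x \<otimes> b [^] k = a [^] i \<otimes> b [^] (j + k)"
      by (simp add: m_assoc nat_pow_mult)
    then show ?thesis unfolding S_def by blast
  qed
  have Sa: "x \<otimes> a \<in> S" if x: "x \<in> S" for x
  proof -
    obtain i j :: nat where "x = a [^] i \<otimes> b [^] j" using x unfolding S_def by blast
    then have "x \<otimes> a = a [^] Suc i \<otimes> b [^] (j * s)"
      by (simp add: m_assoc bja)
    then show ?thesis unfolding S_def by blast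
  qed
  have S_carrier: "x \<in> carrier G" if "x \<in> S" for x using that by (auto simp: S_def)
  have Sak: "x \<otimes> a [^] k \<in> S" if x: "x \<in> S" for x and k :: nat
    by (induction k) (use x S_carrier Sa in \<open>simp_all flip: m_assoc\<close>)
  \<comment> \<open>Inverses of \<open>a\<close> and \<open>b\<close> become positive powers, so
    closure of \<open>S\<close> under right multiplication by them follows from \<open>Sak\<close>
    and \<open>Sb\<close>.\<close>
  have inv: "inv x = x [^] (k - 1)" if "x \<in> carrier G" "x [^] k = \<one>" "k > 0" for x and k :: nat
    using that by (intro inv_equality) (simp_all flip: nat_pow_Suc)
  have "x \<otimes> (if t then g c else inv g c) \<in> S" if "x \<in> S" for x c t
  proof -
    have "x \<otimes> a \<in> S" "x \<otimes> inv a \<in> S" "x \<otimes> b \<in> S" "x \<otimes> inv b \<in> S"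
      using Sa[OF that] Sak[OF that, of "m - 1"] Sb[OF that, of 1] Sb[OF that, of "n - 1"]
      by (simp_all add: inv[OF _ a mn(1)] inv[OF _ b mn(2)])
    moreover have "g c = a \<or> g c = b" using ab by auto
    ultimately show ?thesis by auto
  qed
  then have "word_eval G g u \<in> S"
  proof (induction u rule: rev_induct)
    case Nil
    have "\<one> = a [^] (0::nat) \<otimes> b [^] (0::nat)" by simp
    then show ?case unfolding S_def word_eval.simps by blast
  next
    case (snoc x u)
    then show ?case using g by (simp add: word_eval_append range_subsetD)
  qed
  then obtain i j :: nat where "word_eval G g u = a [^] (i mod m) \<otimes> b [^] (j mod n)"
    using a b by (auto simp: S_def pow_mod)
  then show ?thesis using mn by force
qed

end

text \<open>The generator classes generate the presented group, which makes results about
  \<open>word_eval\<close> applicable to its elements.\<close>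

lemma word_class_eval:
  "word_class R u = word_eval (presented_group R) (\<lambda>x. word_class R [(x, True)]) u"
proof (induction u)
  case Nil
  show ?case by (simp add: presented_group_def)
next
  case (Cons x u)
  interpret group "presented_group R" by (rule group_presented_group)
  have "word_class R [(c, False)] = inv\<^bsub>presented_group R\<^esub> word_class R [(c, True)]" for c
  proof (rule inv_equality[symmetric])
    have "word_eq R [(c, False), (c, True)] []"
      using word_eq.cancel[of R "[]" c False "[]"] by simp
    then show "word_class R [(c, False)] \<otimes>\<^bsub>presented_group R\<^esub> word_class R [(c, True)] = \<one>\<^bsub>presented_group R\<^esub>"
      by (simp add: presented_group_mult word_class_eq_iff) (simp add: presented_group_def word_class_eq_iff)
  qed (simp_all add: presented_group_def)
  then have "word_class R [x] = (if snd x then word_class R [(fst x, True)]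
      else inv\<^bsub>presented_group R\<^esub> word_class R [(fst x, True)])"
    by (cases x) auto
  then show ?case
    using presented_group_mult[of R "[x]" u] Cons by simp
qed

section \<open>The concrete model of order pq\<close>

text \<open>The pair \<open>(i, j)\<close> stands for \<open>a\<^sup>i b\<^sup>j\<close>; the multiplication follows from \<open>b a = a b\<^sup>r\<close>.\<close>

definition affine_group :: "nat \<Rightarrow> nat \<Rightarrow> int \<Rightarrow> (nat \<times> int) monoid" where
  "affine_group p q r =
     \<lparr>carrier = {..<p} \<times> {0..<int q},
      monoid.mult = (\<lambda>(i, j) (k, l). ((i + k) mod p, (j * r ^ k + l) mod int q)),
      one = (0, 0)\<rparr>"

lemma affine_group_simps [simp]:
  "carrier (affine_group p q r) = {..<p} \<times> {0..<int q}"
  "(i, j) \<otimes>\<^bsub>affine_group p q r\<^esub> (k, l) = ((i + k) mod p, (j * r ^ k + l) mod int q)"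
  "\<one>\<^bsub>affine_group p q r\<^esub> = (0, 0)"
  by (simp_all add: affine_group_def)

text \<open>Justifies reducing first coordinates modulo \<open>p\<close> although they serve as
  exponents of \<open>r\<close>; associativity of the model depends on it.\<close>

lemma power_mod_exponent:
  fixes r m :: int
  assumes "[r ^ p = 1] (mod m)"
  shows "[r ^ (k mod p) = r ^ k] (mod m)"
proof -
  have "r ^ k = (r ^ p) ^ (k div p) * r ^ (k mod p)"
    by (metis mult_div_mod_eq power_add power_mult)
  moreover have "[(r ^ p) ^ (k div p) * r ^ (k mod p) = 1 ^ (k div p) * r ^ (k mod p)] (mod m)"
    using assms by (intro cong_mult cong_pow cong_refl)
  ultimately show ?thesis by (simp add: cong_sym)
qed

lemma group_affine_group:
  assumes pq: "p > 0" "q > 0" and r: "[r ^ p = 1] (mod int q)"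
  shows "group (affine_group p q r)"
proof (rule groupI)
  fix x y z
  assume "x \<in> carrier (affine_group p q r)" "y \<in> carrier (affine_group p q r)"
    "z \<in> carrier (affine_group p q r)"
  obtain i j k l m n where [simp]: "x = (i, j)" "y = (k, l)" "z = (m, n)"
    by (metis surj_pair)
  have "[(j * r ^ k + l) mod int q * r ^ m + n = (j * r ^ k + l) * r ^ m + n] (mod int q)"
    by (intro cong_add cong_mult) simp_all
  also have "(j * r ^ k + l) * r ^ m + n = j * r ^ (k + m) + (l * r ^ m + n)"
    by (simp add: algebra_simps power_add)
  also have "[\<dots> = j * r ^ ((k + m) mod p) + (l * r ^ m + n) mod int q] (mod int q)"
    using power_mod_exponent[OF r] by (intro cong_add cong_mult) (simp_all add: cong_sym)
  finally show "x \<otimes>\<^bsub>affine_group p q r\<^esub> y \<otimes>\<^bsub>affine_group p q r\<^esub> z =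
      x \<otimes>\<^bsub>affine_group p q r\<^esub> (y \<otimes>\<^bsub>affine_group p q r\<^esub> z)"
    by (simp add: cong_def mod_simps add.assoc)
next
  fix x assume "x \<in> carrier (affine_group p q r)"
  then obtain i j where x: "x = (i, j)" "i < p" by auto
  \<comment> \<open>The left inverse of \<open>(i, j)\<close> has second coordinate
    \<open>- j * r ^ (p - i)\<close>, as \<open>r ^ (p - i) * r ^ i = r ^ p\<close> is 1 modulo
    \<open>q\<close>. For \<open>i = 0\<close> its first coordinate \<open>p - i\<close> still has
    to be reduced modulo \<open>p\<close>.\<close>
  have "[- j * r ^ (p - i) mod int q * r ^ i + j = - j * r ^ (p - i) * r ^ i + j] (mod int q)"
    by (intro cong_add cong_mult) simp_all
  also have "- j * r ^ (p - i) * r ^ i + j = - j * r ^ p + j"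
    using x by (simp flip: power_add)
  also have "[\<dots> = - j * 1 + j] (mod int q)"
    using r by (intro cong_add cong_mult) simp_all
  finally have "((p - i) mod p, - j * r ^ (p - i) mod int q) \<otimes>\<^bsub>affine_group p q r\<^esub> x = \<one>\<^bsub>affine_group p q r\<^esub>"
    using x by (simp add: cong_def mod_simps)
  then show "\<exists>y\<in>carrier (affine_group p q r). y \<otimes>\<^bsub>affine_group p q r\<^esub> x = \<one>\<^bsub>affine_group p q r\<^esub>"
    using pq by (intro bexI[of _ "((p - i) mod p, - j * r ^ (p - i) mod int q)"]) simp_all
qed (use pq in auto)

lemma affine_group_pow:
  assumes pq: "p > 1" "q > 1" and r: "[r ^ p = 1] (mod int q)"
  shows "(Suc 0, 0) [^]\<^bsub>affine_group p q r\<^esub> n = (n mod p, 0)"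
    and "(0, 1) [^]\<^bsub>affine_group p q r\<^esub> n = (0, int n mod int q)"
    and "(0, 1) [^]\<^bsub>affine_group p q r\<^esub> k = (0, k mod int q)"
proof -
  interpret group "affine_group p q r" using pq r by (intro group_affine_group) auto
  show "(Suc 0, 0) [^]\<^bsub>affine_group p q r\<^esub> n = (n mod p, 0)"
    by (induction n) (simp_all add: mod_simps)
  show b: "(0, 1) [^]\<^bsub>affine_group p q r\<^esub> n = (0, int n mod int q)" for n :: nat
    by (induction n) (simp_all add: mod_simps add.commute)
  show "(0, 1) [^]\<^bsub>affine_group p q r\<^esub> k = (0, k mod int q)"
  proof (cases k rule: int_cases2)
    case (nonneg n)
    then show ?thesis by (simp add: int_pow_int b)
  next
    case (nonpos n)
    have "inv\<^bsub>affine_group p q r\<^esub> (0, int n mod int q) = (0, - int n mod int q)"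
      using pq by (intro inv_equality) (simp_all add: mod_simps)
    then show ?thesis using nonpos pq by (simp add: int_pow_neg_int b)
  qed
qed

section \<open>The presented group is isomorphic to the model\<close>

text \<open>The relations hold in the model, which gives a surjective homomorphism onto a group of
  order \<open>p * q\<close>; the normal form bounds the presented group by the same number, so the
  map is injective.\<close>

lemma F_group_iso_affine_group:
  assumes pq: "p > 1" "q > 1" and r: "[r ^ p = 1] (mod int q)"
  shows "F_group p q r \<cong> affine_group p q r"
proof -
  let ?M = "affine_group p q r"
  define R where "R = {(gen_pow gen_a (int p), []), (gen_pow gen_b (int q), []),
    (gen_pow gen_a (- 1) @ gen_pow gen_b 1 @ gen_pow gen_a 1, gen_pow gen_b r)}"
  let ?F = "presented_group R"
  have R: "(gen_pow gen_a (int p), []) \<in> R" "(gen_pow gen_b (int q), []) \<in> R"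
    "(gen_pow gen_a (- 1) @ gen_pow gen_b 1 @ gen_pow gen_a 1, gen_pow gen_b r) \<in> R"
    by (simp_all add: R_def)
  have F_eq: "F_group p q r = ?F" by (simp add: F_group_def R_def)
  interpret M: group ?M using pq r by (intro group_affine_group) auto
  interpret F: group ?F by (rule group_presented_group)
  define g where "g = (\<lambda>x. case x of gen_a \<Rightarrow> (1::nat, 0::int) | gen_b \<Rightarrow> (0, 1))"
  have g: "range g \<subseteq> carrier ?M"
    using pq by (auto simp: g_def split: F_gen.splits)
  have gens: "UNIV = {gen_a, gen_b}" using F_gen.exhaust by blast

  have "(0, 1) \<otimes>\<^bsub>?M\<^esub> (1, 0) = (1, 0) \<otimes>\<^bsub>?M\<^esub> (0, r mod int q)"
    using pq by simp
  then have "inv\<^bsub>?M\<^esub> (1, 0) \<otimes>\<^bsub>?M\<^esub> ((0, 1) \<otimes>\<^bsub>?M\<^esub> (1, 0)) = (0, 1) [^]\<^bsub>?M\<^esub> r"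
    using pq by (subst M.inv_solve_left') (simp_all add: affine_group_pow[OF pq r])
  moreover have "(1, 0) [^]\<^bsub>?M\<^esub> (- 1 :: int) = inv\<^bsub>?M\<^esub> (1, 0)"
    using pq M.int_pow_neg_int[of "(1, 0)" 1] by simp
  ultimately have rel: "word_eval ?M g l = word_eval ?M g s" if "(l, s) \<in> R" for l s
    using that pq g
    by (auto simp: R_def M.word_eval_append M.word_eval_gen_pow g_def affine_group_pow[OF pq r] int_pow_int)

  \<comment> \<open>Evaluation of a chosen representative; \<open>word_eval_eq\<close> makes the
    choice immaterial.\<close>
  define h where "h X = word_eval ?M g (SOME u. X = word_class R u)" for X
  have h: "h (word_class R u) = word_eval ?M g u" for u
  proof -
    have "word_class R u = word_class R (SOME v. word_class R u = word_class R v)"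
      by (rule someI) (rule HOL.refl)
    then show ?thesis
      unfolding h_def word_class_eq_iff using M.word_eval_eq[OF g rel] by metis
  qed
  have carrier_F: "carrier ?F = range (word_class R)" by (simp add: presented_group_def)
  have "h \<in> hom ?F ?M"
  proof (rule homI)
    fix X Y assume "X \<in> carrier ?F" "Y \<in> carrier ?F"
    then show "h (X \<otimes>\<^bsub>?F\<^esub> Y) = h X \<otimes>\<^bsub>?M\<^esub> h Y"
      using g by (auto simp: carrier_F presented_group_mult h M.word_eval_append)
  qed (use g M.word_eval_closed in \<open>auto simp: carrier_F h simp del: affine_group_simps(1)\<close>)
  moreover have "bij_betw h (carrier ?F) (carrier ?M)"
  proof -
    have surj: "h ` carrier ?F = carrier ?M"
    proof
      show "h ` carrier ?F \<subseteq> carrier ?M"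
        using g M.word_eval_closed by (auto simp: carrier_F h simp del: affine_group_simps(1))
      show "carrier ?M \<subseteq> h ` carrier ?F"
      proof
        fix z assume "z \<in> carrier ?M"
        then obtain i k where z: "z = (i, k)" "i < p" "0 \<le> k" "k < int q" by auto
        \<comment> \<open>The pair \<open>(i, k)\<close> is the image of the word for
          \<open>a^i b^k\<close>.\<close>
        have "h (word_class R (gen_pow gen_a (int i) @ gen_pow gen_b k)) = z"
          using g z by (simp add: h M.word_eval_append M.word_eval_gen_pow g_def
              affine_group_pow[OF pq r] int_pow_int)
        then show "z \<in> h ` carrier ?F" unfolding carrier_F by blast
      qed
    qed
    define c where "c x = word_class R [(x, True)]" for x
    have c: "range c \<subseteq> carrier ?F" by (auto simp: c_def carrier_F)
    have class_eval: "word_class R u = word_eval ?F c u" for u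
      unfolding c_def by (rule word_class_eval)
    have rel_F: "word_eval ?F c l = word_eval ?F c s" if "(l, s) \<in> R" for l s
      using word_eq.relation[OF that, of "[]" "[]"] by (simp add: word_class_eq_iff flip: class_eval)
    have "carrier ?F \<subseteq> (\<lambda>(i, j). c gen_a [^]\<^bsub>?F\<^esub> i \<otimes>\<^bsub>?F\<^esub> c gen_b [^]\<^bsub>?F\<^esub> j) ` ({..<p} \<times> {..<q})"
      (is "_ \<subseteq> ?f ` ?I")
    proof
      fix X assume "X \<in> carrier ?F"
      then obtain u where "X = word_eval ?F c u" by (auto simp: carrier_F class_eval)
      moreover have "range c = {c gen_a, c gen_b}" by (simp add: gens)
      moreover have "c gen_a [^]\<^bsub>?F\<^esub> p = \<one>\<^bsub>?F\<^esub>" "c gen_b [^]\<^bsub>?F\<^esub> q = \<one>\<^bsub>?F\<^esub>"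
        using rel_F[OF R(1)] rel_F[OF R(2)] by (simp_all add: F.word_eval_gen_pow[OF c] int_pow_int)
      moreover have "inv\<^bsub>?F\<^esub> c gen_a \<otimes>\<^bsub>?F\<^esub> c gen_b \<otimes>\<^bsub>?F\<^esub> c gen_a = c gen_b [^]\<^bsub>?F\<^esub> r"
      proof -
        have "c gen_a [^]\<^bsub>?F\<^esub> (- 1 :: int) = inv\<^bsub>?F\<^esub> c gen_a"
          using c F.int_pow_neg_int[of "c gen_a" 1] by auto
        then show ?thesis
          using c rel_F[OF R(3)]
          by (simp add: F.word_eval_append F.word_eval_gen_pow F.m_assoc range_subsetD)
      qed
      ultimately show "X \<in> ?f ` ?I"
        using F.metacyclic_normal_form[OF c] pq by simp
    qed
    then have "card (carrier ?F) \<le> card ?I" and fin: "finite (carrier ?F)"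
      by (meson finite_SigmaI finite_lessThan surj_card_le, meson finite_SigmaI finite_imageI finite_lessThan finite_subset)
    moreover have "card ?I = card (carrier ?M)" by (simp add: card_cartesian_product)
    \<comment> \<open>Surjectivity and the upper bound force equal cardinalities, hence
      injectivity.\<close>
    ultimately have "card (h ` carrier ?F) = card (carrier ?F)"
      using surj card_image_le[OF fin, of h] by simp
    then have "inj_on h (carrier ?F)" by (rule eq_card_imp_inj_on[OF fin])
    then show ?thesis using surj by (simp only: bij_betw_def)
  qed
  ultimately show ?thesis
    unfolding F_eq is_iso_def iso_def by blast
qed

section \<open>Transfer of the structure to an isomorphic group\<close>

lemma pq_group_F_group:
  assumes "prime p" "prime q" "[q = 1] (mod p)"
    and r: "[r ^ p = 1] (mod int q)" "\<not> [r = 1] (mod int q)"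
    and "group G" "G \<cong> F_group p q r"
  obtains N where "pq_group G p q N"
proof -
  interpret group G by fact
  let ?M = "affine_group p q r"
  have pq: "p > 1" "q > 1" using assms(1,2) by (auto simp: prime_gt_Suc_0_nat)
  have "p dvd q - 1" using assms(3) pq by (metis cong_altdef_nat less_imp_le cong_sym)
  then have "p < q" using pq by (metis dvd_imp_le leD less_diff_conv not_less zero_less_diff diff_less zero_less_one le_less_trans less_trans)
  obtain \<phi> where \<phi>: "\<phi> \<in> iso G ?M"
    using assms(7) F_group_iso_affine_group[OF pq r(1)] iso_trans unfolding is_iso_def by blast
  then have bij: "bij_betw \<phi> (carrier G) ({..<p} \<times> {0..<int q})"
    by (simp add: iso_def)
  have mult: "\<phi> (x \<otimes>\<^bsub>G\<^esub> y) = \<phi> x \<otimes>\<^bsub>?M\<^esub> \<phi> y" if "x \<in> carrier G" "y \<in> carrier G" for x y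
    using \<phi> that by (auto simp: iso_def hom_def)
  have closed: "\<phi> x \<in> {..<p} \<times> {0..<int q}" if "x \<in> carrier G" for x
    using bij that by (auto simp: bij_betw_def)
  \<comment> \<open>The first coordinate is the projection killing \<open>b\<close>; its kernel
    serves as \<open>N\<close>. The elements of \<open>integer_mod_group p\<close> are integers,
    hence the conversion.\<close>
  have "(\<lambda>x. int (fst (\<phi> x))) \<in> hom G (integer_mod_group p)"
  proof (rule homI)
    fix x assume "x \<in> carrier G"
    then show "int (fst (\<phi> x)) \<in> carrier (integer_mod_group p)"
      using closed[of x] by (auto simp: carrier_integer_mod_group)
  next
    fix x y assume "x \<in> carrier G" "y \<in> carrier G"
    then show "int (fst (\<phi> (x \<otimes>\<^bsub>G\<^esub> y))) = int (fst (\<phi> x)) \<otimes>\<^bsub>integer_mod_group p\<^esub> int (fst (\<phi> y))"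
      by (cases "\<phi> x"; cases "\<phi> y") (simp add: mult mult_integer_mod_group zmod_int)
  qed
  then interpret \<pi>: group_hom G "integer_mod_group p" "\<lambda>x. int (fst (\<phi> x))"
    by (intro group_hom.intro group_hom_axioms.intro is_group group_integer_mod_group)
  let ?N = "kernel G (integer_mod_group p) (\<lambda>x. int (fst (\<phi> x)))"
  have "pq_group G p q ?N"
  proof (intro pq_group.intro pq_group_axioms.intro)
    show "order G = p * q"
      using bij_betw_same_card[OF bij] by (simp add: order_def card_cartesian_product)
    show "?N \<lhd> G" by (rule \<pi>.normal_kernel)
    have "?N = carrier G \<inter> \<phi> -` ({0} \<times> {0..<int q})"
      using closed by (fastforce simp: kernel_def)
    then have "\<phi> ` ?N = \<phi> ` carrier G \<inter> ({0} \<times> {0..<int q})" by blast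
    also have "\<dots> = {0} \<times> {0..<int q}" using bij pq by (auto simp: bij_betw_def)
    finally have image: "\<phi> ` ?N = {0} \<times> {0..<int q}" .
    have "inj_on \<phi> ?N"
      using bij by (auto simp: bij_betw_def kernel_def intro: inj_on_subset)
    then have "card ?N = card ({0 :: nat} \<times> {0..<int q})"
      unfolding image[symmetric] by (rule card_image[symmetric])
    then show "card ?N = q" by (simp add: card_cartesian_product)
    \<comment> \<open>The preimages of \<open>a\<close> and \<open>b\<close> fail to commute: the
      products in the model have second coordinates 1 and \<open>r\<close> modulo
      \<open>q\<close>.\<close>
    have "(1, 0) \<in> \<phi> ` carrier G" "(0, 1) \<in> \<phi> ` carrier G"
      using bij pq by (auto simp: bij_betw_def)
    then obtain x y where xy: "x \<in> carrier G" "y \<in> carrier G" "\<phi> x = (1, 0)" "\<phi> y = (0, 1)"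
      by (metis imageE)
    then have "\<phi> (x \<otimes>\<^bsub>G\<^esub> y) \<noteq> \<phi> (y \<otimes>\<^bsub>G\<^esub> x)"
      using r(2) pq by (auto simp: mult cong_def)
    then show "\<exists>x\<in>carrier G. \<exists>y\<in>carrier G. x \<otimes>\<^bsub>G\<^esub> y \<noteq> y \<otimes>\<^bsub>G\<^esub> x"
      using xy by metis
  qed fact+
  then show thesis using that by blast
qed

section \<open>The Zagreb indices of the non-Engel graph\<close>

theorem theorem9p3:
  fixes p q :: nat and r :: int and G :: "('a, 'b) monoid_scheme" and \<Gamma> :: "'a sgraph"
  assumes "prime p" and "prime q" and "[q = 1] (mod p)"
    and "[r ^ p = 1] (mod int q)" and "\<not> [r = 1] (mod int q)"
    and "group G" and "G \<cong> F_group p q r"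
    and "\<Gamma> = non_Engel_graph G"
  shows "real (Zagreb1 \<Gamma>) = real q * (real q - 1) ^ 2 * (real p - 1) ^ 3 \<and>
    real (Zagreb2 \<Gamma>) = real q * (real q - 1) ^ 3 * (real p - 1) ^ 4 / 2 \<and>
    real (Zagreb2 \<Gamma>) / real (card (edges \<Gamma>)) = (real q - 1) ^ 2 * (real p - 1) ^ 2 \<and>
    (real q - 1) ^ 2 * (real p - 1) ^ 2 = real (Zagreb1 \<Gamma>) / real (card (vertices \<Gamma>))"
proof -
  obtain N where "pq_group G p q N"
    using pq_group_F_group assms(1-7) by blast
  then interpret pq_group G p q N .
  let ?d = "(q - 1) * (p - 1)"
  have pq: "p > 1" "q > 1" using assms(1,2) by (auto simp: prime_gt_Suc_0_nat)
  have fin: "finite (vertices \<Gamma>)"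
    using finite_G by (simp add: assms(8) non_Engel_graph_eq)
  have edge: "e \<subseteq> vertices \<Gamma> \<and> card e = 2" if "e \<in> edges \<Gamma>" for e
    using that by (auto simp: assms(8) non_Engel_graph_eq)
  have deg: "vertex_degree \<Gamma> v = ?d" if "v \<in> vertices \<Gamma>" for v
    using that degree assms(8) by simp
  note Z = regular_graph_Zagreb[OF fin edge deg]
  have V: "real (card (vertices \<Gamma>)) = real q * (real p - 1)"
    using pq by (simp add: card_vertices assms(8) of_nat_diff)
  have d: "real ?d = (real q - 1) * (real p - 1)"
    using pq by (simp add: of_nat_diff)
  have "2 * real (card (edges \<Gamma>)) = real (card (vertices \<Gamma>)) * real ?d"
    using Z(3) by (metis of_nat_mult of_nat_numeral)
  \<comment> \<open>The handshake identity for a regular graph yields the number of edges.\<close>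
  then have E: "real (card (edges \<Gamma>)) = real q * (real q - 1) * (real p - 1) ^ 2 / 2"
    unfolding V d by (simp add: power2_eq_square algebra_simps)
  have Z1: "real (Zagreb1 \<Gamma>) = real (card (vertices \<Gamma>)) * ((real q - 1) * (real p - 1)) ^ 2"
    and Z2: "real (Zagreb2 \<Gamma>) = real (card (edges \<Gamma>)) * ((real q - 1) * (real p - 1)) ^ 2"
    using Z(1,2) d by (metis of_nat_mult of_nat_power)+
  \<comment> \<open>Nonzero counts allow cancellation in both quotients, leaving the squared
    degree.\<close>
  have "real (card (vertices \<Gamma>)) \<noteq> 0" "real (card (edges \<Gamma>)) \<noteq> 0"
    unfolding V E using pq by auto
  then have "real (Zagreb2 \<Gamma>) / real (card (edges \<Gamma>)) = (real q - 1) ^ 2 * (real p - 1) ^ 2"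
    and "real (Zagreb1 \<Gamma>) / real (card (vertices \<Gamma>)) = (real q - 1) ^ 2 * (real p - 1) ^ 2"
    unfolding Z1 Z2 by (simp_all add: power_mult_distrib)
  then show ?thesis
    by (simp add: Z1 Z2 V E power2_eq_square power3_eq_cube power4_eq_xxxx)
qed

end
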